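(* Let $\psi$ and $\phi$ be acyclic directed graphs (causal networks), i.e. objects of $\mathsf{Cau}$, and let $f:\psi\to\phi$ be a morphism in $\mathsf{Cau}$, i.e. a functor $f:F(\psi)\to F(\phi)$ between their path categories. Then $f$ can be decomposed into a composition of elementary morphisms, i.e. there exist elementary morphisms $f_1,\dots,f_n$ in $\mathsf{Cau}$ such that $f=f_n\circ\cdots\circ f_1$.
   Context: A directed graph $\phi=(V,E,s,t)$ consists of a set $V$ of vertices, a set $E$ of edges, and source and target maps $s,t:E\to V$; multiple edges between the same vertices are allowed. It is acyclic if it has no directed cycles. The path category (free category) $F(\phi)$ has the vertices of $\phi$ as objects and the directed paths of $\phi$ (including the empty path at each vertex, which is the identity) as morphisms, with composition given by concatenation. A functor $F(\phi)\to F(\phi')$ is determined by its values on vertices and edges. The causal network category $\mathsf{Cau}$ has as objects the acyclic directed graphs (called causal networks); a morphism from $\phi$ to $\phi'$ is a functor $F(\phi)\to F(\phi')$, with the usual composition of functors. A morphism in $\mathsf{Cau}$ is called an elementary morphism if it is induced by an isomorphism of directed graphs or by one of the following operations 1–5 turning a directed graph $\phi$ into a directed graph $\phi'$ (since it is a morphism of $\mathsf{Cau}$, both $\phi$ and $\phi'$ are acyclic): 0. Isomorphism of directed graphs: the induced functor sends each vertex and edge to the corresponding vertex and edge. 1. Adding a vertex $v$ to $\phi$: the induced functor is the inclusion on vertices and edges. 2. Adding an edge $e$ between two vertices $v_1,v_2$ of $\phi$: the induced functor is the inclusion on vertices and edges. 3. Subdividing an edge $e$ of $\phi$ by adding a vertex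 $v$ in the middle of it, so that $e$ is replaced by an edge from $s(e)$ to $v$ and an edge from $v$ to $t(e)$: the induced functor sends $e$ to the length-two path obtained by the subdivision, and every vertex of $\phi$ and every other edge to itself. 4. Coarse-graining of edges: for edges $e_1,\dots,e_n$ of $\phi$ with common source and common target, $s(e_1)=\dots=s(e_n)$ and $t(e_1)=\dots=t(e_n)$, merge them into a single edge $e$ with the same source and target: the induced functor sends each $e_i$ to $e$, and every vertex and every other edge to itself. 5. Coarse-graining of vertices: for a subset $S$ of the vertices of $\phi$, with induced subgraph $\phi(S)$, shrink $\phi(S)$ to a single vertex $p$: the induced functor sends every vertex of $S$ to $p$, every edge of $\phi(S)$ to the identity at $p$, and every other vertex and edge to its corresponding vertex or edge in the shrunk graph.
   Formalization: The graphs ψ and φ are assumed finite, with vertices and edges named from fixed infinite sets; for infinite graphs the claim fails, e.g. for the unique functor from the empty graph to an infinite edgeless graph, as each elementary morphism misses at most one vertex of its target. *)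

theory Defs
  imports "Graph_Theory.Graph_Theory"
begin

section \<open>Categories and functors\<close>

text \<open>Composition is written in the usual order: \<open>Comp C g f\<close> is \<open>g \<circ> f\<close>.\<close>

record ('o, 'm) category_data =
  Obj :: "'o set"
  Mor :: "'m set"
  Dom :: "'m \<Rightarrow> 'o"
  Cod :: "'m \<Rightarrow> 'o"
  Ident :: "'o \<Rightarrow> 'm"
  Comp :: "'m \<Rightarrow> 'm \<Rightarrow> 'm"

locale category =
  fixes C :: "('o, 'm) category_data"
  assumes Dom_in: "f \<in> Mor C \<Longrightarrow> Dom C f \<in> Obj C"
    and Cod_in: "f \<in> Mor C \<Longrightarrow> Cod C f \<in> Obj C"
    and Ident_in: "x \<in> Obj C \<Longrightarrow> Ident C x \<in> Mor C"
    and Dom_Ident: "x \<in> Obj C \<Longrightarrow> Dom C (Ident C x) = x"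
    and Cod_Ident: "x \<in> Obj C \<Longrightarrow> Cod C (Ident C x) = x"
    and Comp_in: "f \<in> Mor C \<Longrightarrow> g \<in> Mor C \<Longrightarrow> Cod C f = Dom C g \<Longrightarrow> Comp C g f \<in> Mor C"
    and Dom_Comp: "f \<in> Mor C \<Longrightarrow> g \<in> Mor C \<Longrightarrow> Cod C f = Dom C g \<Longrightarrow> Dom C (Comp C g f) = Dom C f"
    and Cod_Comp: "f \<in> Mor C \<Longrightarrow> g \<in> Mor C \<Longrightarrow> Cod C f = Dom C g \<Longrightarrow> Cod C (Comp C g f) = Cod C g"
    and Comp_Ident_right: "f \<in> Mor C \<Longrightarrow> Comp C f (Ident C (Dom C f)) = f"
    and Comp_Ident_left: "f \<in> Mor C \<Longrightarrow> Comp C (Ident C (Cod C f)) f = f"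
    and Comp_assoc: "f \<in> Mor C \<Longrightarrow> g \<in> Mor C \<Longrightarrow> h \<in> Mor C \<Longrightarrow>
      Cod C f = Dom C g \<Longrightarrow> Cod C g = Dom C h \<Longrightarrow>
      Comp C h (Comp C g f) = Comp C (Comp C h g) f"

record ('o1, 'm1, 'o2, 'm2) functor_data =
  omap :: "'o1 \<Rightarrow> 'o2"
  mmap :: "'m1 \<Rightarrow> 'm2"

definition is_functor ::
  "('o1, 'm1) category_data \<Rightarrow> ('o2, 'm2) category_data \<Rightarrow> ('o1, 'm1, 'o2, 'm2) functor_data \<Rightarrow> bool"
where
  "is_functor C D F \<longleftrightarrow> category C \<and> category D \<and>
     (\<forall>x\<in>Obj C. omap F x \<in> Obj D) \<and>
     (\<forall>f\<in>Mor C. mmap F f \<in> Mor D \<and>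
        Dom D (mmap F f) = omap F (Dom C f) \<and> Cod D (mmap F f) = omap F (Cod C f)) \<and>
     (\<forall>x\<in>Obj C. mmap F (Ident C x) = Ident D (omap F x)) \<and>
     (\<forall>f\<in>Mor C. \<forall>g\<in>Mor C. Cod C f = Dom C g \<longrightarrow>
        mmap F (Comp C g f) = Comp D (mmap F g) (mmap F f))"

text \<open>The values of the two maps outside the source category are irrelevant, so equality of
  functors means agreement on the objects and morphisms of the source.\<close>

definition functor_eq ::
  "('o1, 'm1) category_data \<Rightarrow> ('o1, 'm1, 'o2, 'm2) functor_data \<Rightarrow> ('o1, 'm1, 'o2, 'm2) functor_data \<Rightarrow> bool"
where
  "functor_eq C F F' \<longleftrightarrow>
     (\<forall>x\<in>Obj C. omap F x = omap F' x) \<and> (\<forall>f\<in>Mor C. mmap F f = mmap F' f)"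

definition id_functor :: "('o, 'm, 'o, 'm) functor_data" where
  "id_functor = \<lparr>omap = id, mmap = id\<rparr>"

definition comp_functor ::
  "('o2, 'm2, 'o3, 'm3) functor_data \<Rightarrow> ('o1, 'm1, 'o2, 'm2) functor_data \<Rightarrow> ('o1, 'm1, 'o3, 'm3) functor_data"
  (infixr \<open>\<circ>\<^sub>F\<close> 55)
where
  "G \<circ>\<^sub>F F = \<lparr>omap = omap G \<circ> omap F, mmap = mmap G \<circ> mmap F\<rparr>"

lemma is_functor_comp:
  assumes "is_functor C D F" "is_functor D E G"
  shows "is_functor C E (G \<circ>\<^sub>F F)"
  using assms by (auto simp: is_functor_def comp_functor_def)

text \<open>\<open>comp_functors g n\<close> is \<open>g n \<circ> \<dots> \<circ> g 2 \<circ> g 1\<close>; the value \<open>g 0\<close> is not used.\<close>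

primrec comp_functors :: "(nat \<Rightarrow> ('o, 'm, 'o, 'm) functor_data) \<Rightarrow> nat \<Rightarrow> ('o, 'm, 'o, 'm) functor_data"
where
  "comp_functors g 0 = id_functor"
| "comp_functors g (Suc n) = g (Suc n) \<circ>\<^sub>F comp_functors g n"


section \<open>The path category and the causal network category\<close>

text \<open>A directed path is stored together with its end points, \<open>(u, p, v)\<close>, so that the empty
  paths at different vertices are different morphisms.\<close>

type_synonym ('v, 'e) path = "'v \<times> 'e list \<times> 'v"

definition path_category :: "('v, 'e) pre_digraph \<Rightarrow> ('v, ('v, 'e) path) category_data" where
  "path_category G = \<lparr>
     Obj = verts G,
     Mor = {(u, p, v). pre_digraph.awalk G u p v},
     Dom = (\<lambda>(u, p, v). u),
     Cod = (\<lambda>(u, p, v). v),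
     Ident = (\<lambda>v. (v, [], v)),
     Comp = (\<lambda>(v, q, w) (u, p, v'). (u, p @ q, w))\<rparr>"

lemma (in wf_digraph) category_path_category: "category (path_category G)"
  by unfold_locales (auto simp: path_category_def awalk_Nil_iff)

definition edge_path :: "('v, 'e) pre_digraph \<Rightarrow> 'e \<Rightarrow> ('v, 'e) path" where
  "edge_path G e = (tail G e, [e], head G e)"

locale causal_network = wf_digraph +
  assumes acyclic: "\<not> cycle p"

type_synonym ('v1, 'e1, 'v2, 'e2) path_functor =
  "('v1, ('v1, 'e1) path, 'v2, ('v2, 'e2) path) functor_data"

definition cau_morphism ::
  "('v1, 'e1) pre_digraph \<Rightarrow> ('v2, 'e2) pre_digraph \<Rightarrow> ('v1, 'e1, 'v2, 'e2) path_functor \<Rightarrow> bool"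
where
  "cau_morphism G H F \<longleftrightarrow> causal_network G \<and> causal_network H \<and>
     is_functor (path_category G) (path_category H) F"


section \<open>Elementary morphisms\<close>

text \<open>Each predicate below says that \<open>H\<close> arises from \<open>G\<close> by the operation in question and that
  \<open>F\<close> has the prescribed values on the vertices and edges of \<open>G\<close>. The source and target maps of
  \<open>H\<close> are constrained on \<open>arcs H\<close> only. A vertex or edge introduced by an operation must be
  distinct from those that survive, but it may reuse the name of one that is removed.\<close>

definition same_ends_on :: "'e set \<Rightarrow> ('v, 'e) pre_digraph \<Rightarrow> ('v, 'e) pre_digraph \<Rightarrow> bool" where
  "same_ends_on A G H \<longleftrightarrow> (\<forall>a\<in>A. tail H a = tail G a \<and> head H a = head G a)"

definition induced_by_isomorphism ::
  "('v1, 'e1) pre_digraph \<Rightarrow> ('v2, 'e2) pre_digraph \<Rightarrow> ('v1, 'e1, 'v2, 'e2) path_functor \<Rightarrow> bool"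
where
  "induced_by_isomorphism G H F \<longleftrightarrow>
     (\<exists>h. pre_digraph.digraph_isomorphism G h \<and> H = app_iso h G \<and>
        (\<forall>x\<in>verts G. omap F x = iso_verts h x) \<and>
        (\<forall>a\<in>arcs G. mmap F (edge_path G a) = edge_path H (iso_arcs h a)))"

definition induced_by_adding_vertex ::
  "('v, 'e) pre_digraph \<Rightarrow> ('v, 'e) pre_digraph \<Rightarrow> ('v, 'e, 'v, 'e) path_functor \<Rightarrow> bool"
where
  "induced_by_adding_vertex G H F \<longleftrightarrow>
     (\<exists>v. v \<notin> verts G \<and>
        verts H = insert v (verts G) \<and> arcs H = arcs G \<and> same_ends_on (arcs G) G H \<and>
        (\<forall>x\<in>verts G. omap F x = x) \<and>
        (\<forall>a\<in>arcs G. mmap F (edge_path G a) = edge_path H a))"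

definition induced_by_adding_edge ::
  "('v, 'e) pre_digraph \<Rightarrow> ('v, 'e) pre_digraph \<Rightarrow> ('v, 'e, 'v, 'e) path_functor \<Rightarrow> bool"
where
  "induced_by_adding_edge G H F \<longleftrightarrow>
     (\<exists>e v1 v2. e \<notin> arcs G \<and> v1 \<in> verts G \<and> v2 \<in> verts G \<and>
        verts H = verts G \<and> arcs H = insert e (arcs G) \<and> same_ends_on (arcs G) G H \<and>
        tail H e = v1 \<and> head H e = v2 \<and>
        (\<forall>x\<in>verts G. omap F x = x) \<and>
        (\<forall>a\<in>arcs G. mmap F (edge_path G a) = edge_path H a))"

definition induced_by_subdividing_edge ::
  "('v, 'e) pre_digraph \<Rightarrow> ('v, 'e) pre_digraph \<Rightarrow> ('v, 'e, 'v, 'e) path_functor \<Rightarrow> bool"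
where
  "induced_by_subdividing_edge G H F \<longleftrightarrow>
     (\<exists>e v e1 e2. e \<in> arcs G \<and> v \<notin> verts G \<and>
        e1 \<noteq> e2 \<and> e1 \<notin> arcs G - {e} \<and> e2 \<notin> arcs G - {e} \<and>
        verts H = insert v (verts G) \<and> arcs H = arcs G - {e} \<union> {e1, e2} \<and>
        same_ends_on (arcs G - {e}) G H \<and>
        tail H e1 = tail G e \<and> head H e1 = v \<and> tail H e2 = v \<and> head H e2 = head G e \<and>
        (\<forall>x\<in>verts G. omap F x = x) \<and>
        mmap F (edge_path G e) = (tail G e, [e1, e2], head G e) \<and>
        (\<forall>a\<in>arcs G - {e}. mmap F (edge_path G a) = edge_path H a))"

definition induced_by_coarse_graining_edges ::
  "('v, 'e) pre_digraph \<Rightarrow> ('v, 'e) pre_digraph \<Rightarrow> ('v, 'e, 'v, 'e) path_functor \<Rightarrow> bool"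
where
  "induced_by_coarse_graining_edges G H F \<longleftrightarrow>
     (\<exists>A e u v. A \<subseteq> arcs G \<and> finite A \<and> A \<noteq> {} \<and> (\<forall>a\<in>A. tail G a = u \<and> head G a = v) \<and>
        e \<notin> arcs G - A \<and>
        verts H = verts G \<and> arcs H = insert e (arcs G - A) \<and>
        same_ends_on (arcs G - A) G H \<and> tail H e = u \<and> head H e = v \<and>
        (\<forall>x\<in>verts G. omap F x = x) \<and>
        (\<forall>a\<in>A. mmap F (edge_path G a) = edge_path H e) \<and>
        (\<forall>a\<in>arcs G - A. mmap F (edge_path G a) = edge_path H a))"

text \<open>\<open>G \<restriction> S\<close> is the induced subgraph. For \<open>S = {}\<close> the operation is the addition of
  the vertex \<open>p\<close>, which is elementary anyway.\<close>

definition induced_by_coarse_graining_vertices ::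
  "('v, 'e) pre_digraph \<Rightarrow> ('v, 'e) pre_digraph \<Rightarrow> ('v, 'e, 'v, 'e) path_functor \<Rightarrow> bool"
where
  "induced_by_coarse_graining_vertices G H F \<longleftrightarrow>
     (\<exists>S p. S \<subseteq> verts G \<and> p \<notin> verts G - S \<and>
        verts H = insert p (verts G - S) \<and> arcs H = arcs G - arcs (G \<restriction> S) \<and>
        (\<forall>a\<in>arcs H. tail H a = (if tail G a \<in> S then p else tail G a) \<and>
                     head H a = (if head G a \<in> S then p else head G a)) \<and>
        (\<forall>x\<in>S. omap F x = p) \<and>
        (\<forall>x\<in>verts G - S. omap F x = x) \<and>
        (\<forall>a\<in>arcs (G \<restriction> S). mmap F (edge_path G a) = Ident (path_category H) p) \<and>
        (\<forall>a\<in>arcs G - arcs (G \<restriction> S). mmap F (edge_path G a) = edge_path H a))"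

text \<open>An elementary morphism misses at most one vertex and one edge of its target, and subdivides
  at most one edge of its source. A composition of finitely many of them therefore cannot
  reach every morphism between infinite networks (for instance the one from the empty network to
  an infinite edgeless one). Statements about such decompositions need finite networks, and
  vertex and edge types that are infinite, so that there are always fresh names.\<close>

definition elementary ::
  "('v, 'e) pre_digraph \<Rightarrow> ('v, 'e) pre_digraph \<Rightarrow> ('v, 'e, 'v, 'e) path_functor \<Rightarrow> bool"
where
  "elementary G H F \<longleftrightarrow> cau_morphism G H F \<and>
     (induced_by_isomorphism G H F \<or>
      induced_by_adding_vertex G H F \<or>
      induced_by_adding_edge G H F \<or>
      induced_by_subdividing_edge G H F \<or>
      induced_by_coarse_graining_edges G H F \<or>
      induced_by_coarse_graining_vertices G H F)"

end

theory Submission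
  imports Defs
begin

text \<open>
  A functor between path categories is given by a vertex map \<open>\<omega>\<close> and a map \<open>P\<close> sending each edge to
  a list of edges. Subdividing edges makes every \<open>P a\<close> of length at most one. Shrinking the fibres
  of \<open>\<omega>\<close> one at a time then makes \<open>\<omega>\<close> injective, which forces every \<open>P a\<close> to be a single edge.
  Merging the edges that have the same image yields an isomorphism onto a subgraph of \<open>\<phi>\<close>, and the
  missing vertices and edges are added last. The intermediate graphs are acyclic because a
  closed walk in one of them is sent to a closed walk in \<open>\<phi>\<close>, so that it consists of edges that are
  sent to identities; such edges have the same ends as in the previous graph.
\<close>

section \<open>Functors given by their values on vertices and edges\<close>

lemma path_category_simps [simp]:
  "Obj (path_category G) = verts G"
  "(u, p, v) \<in> Mor (path_category G) \<longleftrightarrow> pre_digraph.awalk G u p v"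
  "Dom (path_category G) (u, p, v) = u"
  "Cod (path_category G) (u, p, v) = v"
  "Ident (path_category G) v = (v, [], v)"
  "Comp (path_category G) (v, q, w) (u, p, v') = (u, p @ q, w)"
  by (simp_all add: path_category_def)

definition path_functor_of :: "('v1 \<Rightarrow> 'v2) \<Rightarrow> ('e1 \<Rightarrow> 'e2 list) \<Rightarrow> ('v1, 'e1, 'v2, 'e2) path_functor"
  where "path_functor_of \<omega> P = \<lparr>omap = \<omega>, mmap = \<lambda>(u, p, v). (\<omega> u, concat (map P p), \<omega> v)\<rparr>"

lemma path_functor_of_simps [simp]:
  "omap (path_functor_of \<omega> P) = \<omega>"
  "mmap (path_functor_of \<omega> P) (u, p, v) = (\<omega> u, concat (map P p), \<omega> v)"
  "mmap (path_functor_of \<omega> P) (edge_path G a) = (\<omega> (tail G a), P a, \<omega> (head G a))"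
  by (simp_all add: path_functor_of_def edge_path_def)

text \<open>Path categories are free, so such data on vertices and edges amounts to a functor up to
  \<open>functor_eq\<close>, with no further law to check. The clause on \<omega> takes care of
  isolated vertices.\<close>

definition path_hom ::
  "('v1, 'e1) pre_digraph \<Rightarrow> ('v2, 'e2) pre_digraph \<Rightarrow> ('v1 \<Rightarrow> 'v2) \<Rightarrow> ('e1 \<Rightarrow> 'e2 list) \<Rightarrow> bool"
  where "path_hom G H \<omega> P \<longleftrightarrow> \<omega> ` verts G \<subseteq> verts H \<and>
    (\<forall>a\<in>arcs G. pre_digraph.awalk H (\<omega> (tail G a)) (P a) (\<omega> (head G a)))"

lemma path_hom_awalk:
  assumes "wf_digraph G" "wf_digraph H" "path_hom G H \<omega> P" "pre_digraph.awalk G u p v"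
  shows "pre_digraph.awalk H (\<omega> u) (concat (map P p)) (\<omega> v)"
proof -
  interpret G: wf_digraph G by fact
  interpret H: wf_digraph H by fact
  show ?thesis
    using assms(4)
  proof (induction p arbitrary: u)
    case Nil
    then show ?case using assms(3) by (auto simp: path_hom_def G.awalk_Nil_iff H.awalk_Nil_iff)
  next
    case (Cons a p)
    then have "a \<in> arcs G" "u = tail G a" and "G.awalk (head G a) p v"
      by (auto simp: G.awalk_Cons_iff)
    then show ?case
      using assms(3) Cons.IH[of "head G a"]
      by (auto simp: path_hom_def intro: H.awalk_appendI)
  qed
qed

lemma awalk_singleton_iff:
  assumes "wf_digraph G"
  shows "pre_digraph.awalk G u [a] v \<longleftrightarrow> a \<in> arcs G \<and> tail G a = u \<and> head G a = v"
  using assms by (auto simp: wf_digraph.awalk_Cons_iff wf_digraph.awalk_Nil_iff wf_digraph.head_in_verts)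

lemma is_functor_path_functor_of:
  assumes "wf_digraph G" "wf_digraph H" "path_hom G H \<omega> P"
  shows "is_functor (path_category G) (path_category H) (path_functor_of \<omega> P)"
  using assms wf_digraph.category_path_category[OF assms(1)]
    wf_digraph.category_path_category[OF assms(2)] path_hom_awalk[OF assms]
  by (auto simp: is_functor_def path_hom_def)

text \<open>A walk is the composite of its edges, so functoriality determines \<open>F\<close> on
  all morphisms by induction along the walk.\<close>

lemma functor_eq_path_functor_of:
  assumes "wf_digraph G" "wf_digraph H" "is_functor (path_category G) (path_category H) F"
  obtains \<omega> P where "path_hom G H \<omega> P" "functor_eq (path_category G) F (path_functor_of \<omega> P)"
proof -
  interpret G: wf_digraph G by fact
  interpret H: wf_digraph H by fact
  \<comment> \<open>\<open>P a\<close> is the edge list of the image of \<open>a\<close>; the two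
    end points of that image are recovered below from \<open>Dom\<close> and
    \<open>Cod\<close>.\<close>
  define P where "P = (\<lambda>a. fst (snd (mmap F (edge_path G a))))"
  note F = assms(3)[unfolded is_functor_def]
  have arc: "mmap F (edge_path G a) = (omap F (tail G a), P a, omap F (head G a))"
    "H.awalk (omap F (tail G a)) (P a) (omap F (head G a))" if "a \<in> arcs G" for a
  proof -
    obtain u p v where *: "mmap F (edge_path G a) = (u, p, v)" by (metis prod_cases3)
    have "edge_path G a \<in> Mor (path_category G)"
      using that by (auto simp: edge_path_def awalk_singleton_iff G.wf_digraph_axioms)
    then have "(u, p, v) \<in> Mor (path_category H)" "u = omap F (tail G a)" "v = omap F (head G a)"
      using F * unfolding edge_path_def
      by (metis path_category_simps(3), metis path_category_simps(3), metis path_category_simps(4))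
    then show "mmap F (edge_path G a) = (omap F (tail G a), P a, omap F (head G a))"
      "H.awalk (omap F (tail G a)) (P a) (omap F (head G a))"
      using * by (auto simp: P_def)
  qed
  have walk: "mmap F (u, p, v) = (omap F u, concat (map P p), omap F v)" if "G.awalk u p v" for u p v
    using that
  proof (induction p arbitrary: u)
    case Nil
    then have "u = v" "u \<in> verts G" by (auto simp: G.awalk_Nil_iff)
    then show ?case using F by simp
  next
    case (Cons a p)
    then have a: "a \<in> arcs G" "u = tail G a" and w: "G.awalk (head G a) p v"
      by (auto simp: G.awalk_Cons_iff)
    have "G.awalk u [a] (head G a)" using a by (simp add: awalk_singleton_iff G.wf_digraph_axioms)
    then have "mmap F (Comp (path_category G) (head G a, p, v) (u, [a], head G a)) =
        Comp (path_category H) (mmap F (head G a, p, v)) (mmap F (u, [a], head G a))"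
      using F w by (metis path_category_simps(2-4))
    then show ?case
      using arc(1)[OF a(1)] Cons.IH[OF w] a(2) by (simp add: edge_path_def)
  qed
  show ?thesis
  proof
    show "path_hom G H (omap F) P" using F arc(2) by (auto simp: path_hom_def)
    show "functor_eq (path_category G) F (path_functor_of (omap F) P)"
      using walk by (auto simp: functor_eq_def)
  qed
qed

section \<open>Acyclicity\<close>

text \<open>Functors send closed walks to closed walks, but may destroy the distinctness of vertices
  required by \<open>cycle\<close>. Hence acyclicity is rephrased with arbitrary closed walks, each
  nonempty one of which contains a cycle.\<close>

lemma causal_network_iff:
  "causal_network G \<longleftrightarrow> wf_digraph G \<and> (\<forall>u p. pre_digraph.awalk G u p u \<longrightarrow> p = [])"
proof
  assume "causal_network G"
  then interpret causal_network G .
  show "wf_digraph G \<and> (\<forall>u p. awalk u p u \<longrightarrow> p = [])"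
    using closed_w_imp_cycle acyclic wf_digraph_axioms by (auto simp: closed_w_def)
next
  assume *: "wf_digraph G \<and> (\<forall>u p. pre_digraph.awalk G u p u \<longrightarrow> p = [])"
  then interpret wf_digraph G by simp
  show "causal_network G" by unfold_locales (use * in \<open>auto simp: cycle_def\<close>)
qed

text \<open>Acyclicity of \<open>H\<close> comes from two sides: \<phi> excludes closed walks
  containing an edge with nonempty image, and the previous graph \<open>G\<close> excludes those
  made of collapsed edges only.\<close>

lemma causal_network_lift:
  assumes "causal_network G" "causal_network \<phi>" "wf_digraph H" "path_hom H \<phi> \<omega> P"
    and collapsed: "\<And>a. a \<in> arcs H \<Longrightarrow> P a = [] \<Longrightarrow>
      a \<in> arcs G \<and> tail G a = tail H a \<and> head G a = head H a"
  shows "causal_network H"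
  unfolding causal_network_iff
proof (intro conjI allI impI)
  interpret G: wf_digraph G using assms(1) by (simp add: causal_network_iff)
  interpret H: wf_digraph H by fact
  fix u p assume p: "H.awalk u p u"
  have "concat (map P p) = []"
    using path_hom_awalk[OF assms(3) _ assms(4) p] assms(2) unfolding causal_network_iff by blast
  then have "\<forall>a\<in>set p. P a = []" by simp
  then have arcs: "\<forall>a\<in>set p. a \<in> arcs G \<and> tail G a = tail H a \<and> head G a = head H a"
    using collapsed H.awalkE'[OF p] by blast
  \<comment> \<open>The induction needs distinct end points, since a suffix of a closed walk is in
    general not closed.\<close>
  have "G.cas v p w" if "H.cas v p w" for v w
    using that arcs by (induction p arbitrary: v) auto
  then have "G.cas u p u" using p by auto
  show "p = []"
  proof (cases p)
    case (Cons a q)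
    then have "a \<in> arcs G" "u = tail G a" using arcs \<open>G.cas u p u\<close> by auto
    then have "u \<in> verts G" by simp
    then have "G.awalk u p u" using arcs \<open>G.cas u p u\<close> by (auto simp: G.awalk_def)
    then show ?thesis using assms(1) by (simp add: causal_network_iff)
  qed
qed fact

section \<open>Compositions of elementary morphisms\<close>

text \<open>The target is a fixed parameter and chains grow at their source, because the reductions
  below simplify the source. The base case is one elementary morphism, not an empty composition, so
  chains have length at least one.\<close>

inductive decomposable ::
  "('v, 'e) pre_digraph \<Rightarrow> ('v, 'e) pre_digraph \<Rightarrow> ('v, 'e, 'v, 'e) path_functor \<Rightarrow> bool" for \<phi>
  where
    elementary: "elementary G \<phi> E \<Longrightarrow> functor_eq (path_category G) F E \<Longrightarrow> decomposable \<phi> G F"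
  | compose: "elementary G H E \<Longrightarrow> decomposable \<phi> H F' \<Longrightarrow>
      functor_eq (path_category G) F (F' \<circ>\<^sub>F E) \<Longrightarrow> decomposable \<phi> G F"

text \<open>\<open>comp_functors\<close> grows at the target whereas \<open>decomposable\<close>
  grows at the source; prepending \<open>E\<close> therefore shifts all indices by one. The entry at
  index 0 does not matter.\<close>

lemma comp_functors_Suc_shift:
  "comp_functors (\<lambda>i. if i = Suc 0 then E else g (i - 1)) (Suc n) = comp_functors g n \<circ>\<^sub>F E"
proof (induction n)
  case 0
  then show ?case by (simp add: comp_functor_def id_functor_def)
next
  case (Suc n)
  show ?case by (subst comp_functors.simps, subst Suc) (simp add: comp_functor_def o_assoc)
qed

lemma decomposable_chain:
  assumes "decomposable \<phi> \<psi> F"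
  shows "\<exists>n\<ge>1. \<exists>G g. G 0 = \<psi> \<and> G n = \<phi> \<and>
    (\<forall>i\<in>{1..n}. elementary (G (i - 1)) (G i) (g i)) \<and>
    functor_eq (path_category \<psi>) F (comp_functors g n)"
  using assms
proof induction
  case (elementary G E F)
  define Gs gs where "Gs = (\<lambda>i::nat. if i = 0 then G else \<phi>)" and "gs = (\<lambda>i::nat. E)"
  have "functor_eq (path_category G) F (comp_functors gs 1)"
    using elementary by (simp add: functor_eq_def gs_def comp_functor_def id_functor_def)
  moreover have "\<forall>i\<in>{1..1}. elementary (Gs (i - 1)) (Gs i) (gs i)"
    using elementary by (simp add: Gs_def gs_def)
  moreover have "Gs 0 = G" "Gs 1 = \<phi>" by (simp_all add: Gs_def)
  ultimately show ?case by blast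
next
  case (compose G H E F' F)
  then obtain n Gs gs where n: "n \<ge> 1" "Gs 0 = H" "Gs n = \<phi>"
    and el: "\<forall>i\<in>{1..n}. elementary (Gs (i - 1)) (Gs i) (gs i)"
    and eq: "functor_eq (path_category H) F' (comp_functors gs n)"
    by blast
  define Gs' gs' where "Gs' = (\<lambda>i. if i = 0 then G else Gs (i - 1))"
    and "gs' = (\<lambda>i. if i = Suc 0 then E else gs (i - 1))"
  have "elementary (Gs' (i - 1)) (Gs' i) (gs' i)" if "i \<in> {1..Suc n}" for i
  proof (cases "i = 1")
    case True
    then show ?thesis using compose n by (simp add: Gs'_def gs'_def)
  next
    case False
    then have "i - 1 \<in> {1..n}" "i \<noteq> 0" using that by auto
    then show ?thesis using el[rule_format, of "i - 1"] False by (simp add: Gs'_def gs'_def)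
  qed
  moreover have "functor_eq (path_category G) F (comp_functors gs' (Suc n))"
  proof -
    \<comment> \<open>\<open>F'\<close> and its chain agree only on the path category of
      \<open>H\<close>, so \<open>E\<close> must be known to land there.\<close>
    have "is_functor (path_category G) (path_category H) E"
      using compose.hyps by (simp add: elementary_def cau_morphism_def)
    then show ?thesis
      using compose.hyps(3) eq unfolding gs'_def comp_functors_Suc_shift
      by (auto simp: functor_eq_def comp_functor_def is_functor_def simp del: path_category_simps)
  qed
  moreover have "Gs' 0 = G" "Gs' (Suc n) = \<phi>" using n by (simp_all add: Gs'_def)
  ultimately show ?case by (intro exI[of _ "Suc n"] conjI exI[of _ Gs'] exI[of _ gs']) auto
qed

text \<open>The common form of all reductions: factor the functor through \<open>H\<close>, with an
  elementary first factor. Acyclicity of \<open>H\<close> is derived once here and handed to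
  \<open>op\<close> and \<open>rest\<close>, so that each use only has to exhibit the operation and
  check the factorization on vertices and edges.\<close>

lemma decomposable_step:
  assumes "causal_network G" "causal_network \<phi>" "wf_digraph H"
    and hom: "path_hom G H \<sigma> Q" "path_hom H \<phi> \<omega>' P'"
    and collapsed: "\<And>a. a \<in> arcs H \<Longrightarrow> P' a = [] \<Longrightarrow>
      a \<in> arcs G \<and> tail G a = tail H a \<and> head G a = head H a"
    and op: "cau_morphism G H (path_functor_of \<sigma> Q) \<Longrightarrow> elementary G H (path_functor_of \<sigma> Q)"
    and rest: "causal_network H \<Longrightarrow> decomposable \<phi> H (path_functor_of \<omega>' P')"
    and eq: "\<And>x. x \<in> verts G \<Longrightarrow> \<omega> x = \<omega>' (\<sigma> x)"
      "\<And>a. a \<in> arcs G \<Longrightarrow> P a = concat (map P' (Q a))"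
  shows "decomposable \<phi> G (path_functor_of \<omega> P)"
proof (rule decomposable.compose)
  interpret G: wf_digraph G using assms(1) by (simp add: causal_network_iff)
  have H: "causal_network H" by (rule causal_network_lift[OF assms(1-3) hom(2) collapsed])
  show "elementary G H (path_functor_of \<sigma> Q)"
    by (rule op) (simp add: cau_morphism_def assms H is_functor_path_functor_of G.wf_digraph_axioms)
  show "decomposable \<phi> H (path_functor_of \<omega>' P')" using H by (rule rest)
  have "concat (map P p) = concat (map P' (concat (map Q p)))" if "set p \<subseteq> arcs G" for p
    using that eq(2) by (induction p) auto
  then show "functor_eq (path_category G) (path_functor_of \<omega> P)
      (path_functor_of \<omega>' P' \<circ>\<^sub>F path_functor_of \<sigma> Q)"
    using eq(1) by (auto simp: functor_eq_def comp_functor_def elim!: G.awalkE')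
qed

section \<open>Inclusions and embeddings of graphs\<close>

lemma path_hom_inclusion:
  assumes "wf_digraph H" "verts G \<subseteq> verts H" "arcs G \<subseteq> arcs H" "same_ends_on (arcs G) G H"
  shows "path_hom G H (\<lambda>x. x) (\<lambda>a. [a])"
  using assms by (auto simp: path_hom_def awalk_singleton_iff same_ends_on_def)

text \<open>End point of the recursion: as chains are nonempty, the identity is counted as an
  isomorphism.\<close>

lemma decomposable_identity:
  assumes "causal_network \<phi>"
  shows "decomposable \<phi> \<phi> (path_functor_of (\<lambda>x. x) (\<lambda>a. [a]))"
proof (rule decomposable.elementary)
  interpret wf_digraph \<phi> using assms by (simp add: causal_network_iff)
  \<comment> \<open>\<open>app_iso\<close> takes its end maps from \<open>iso_head\<close> and
    \<open>iso_tail\<close>; choosing those of \<phi> makes the image equal to \<phi>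
    itself.\<close>
  let ?h = "\<lparr>iso_verts = \<lambda>x. x, iso_arcs = \<lambda>a. a, iso_head = head \<phi>, iso_tail = tail \<phi>\<rparr>"
  have "digraph_isomorphism ?h"
    by (auto simp: digraph_isomorphism_def inj_on_def intro: wf_digraph_axioms)
  then have "induced_by_isomorphism \<phi> \<phi> (path_functor_of (\<lambda>x. x) (\<lambda>a. [a]))"
    unfolding induced_by_isomorphism_def
    by (intro exI[of _ ?h]) (auto simp: app_iso_def edge_path_def)
  then show "elementary \<phi> \<phi> (path_functor_of (\<lambda>x. x) (\<lambda>a. [a]))"
    using assms
    by (auto simp: elementary_def cau_morphism_def same_ends_on_def wf_digraph_axioms
        intro!: is_functor_path_functor_of path_hom_inclusion)
qed (simp add: functor_eq_def)

text \<open>Missing vertices and edges are added one by one. The end maps agree as total functions,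
  so that \<open>G\<close> equals \<phi> as a record once nothing is missing.\<close>

lemma decomposable_inclusion:
  assumes "causal_network \<phi>" "fin_digraph \<phi>" "causal_network G"
    and "verts G \<subseteq> verts \<phi>" "arcs G \<subseteq> arcs \<phi>" "tail G = tail \<phi>" "head G = head \<phi>"
  shows "decomposable \<phi> G (path_functor_of (\<lambda>x. x) (\<lambda>a. [a]))"
  using assms(3-)
proof (induction "card (verts \<phi> - verts G) + card (arcs \<phi> - arcs G)" arbitrary: G rule: less_induct)
  case less
  interpret phi: fin_digraph \<phi> by fact
  interpret G: wf_digraph G using less by (simp add: causal_network_iff)
  \<comment> \<open>Edges are added only after all vertices, so that their ends are already
    present.\<close>
  consider "verts G = verts \<phi>" "arcs G = arcs \<phi>" | v where "v \<in> verts \<phi> - verts G"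
    | e where "verts G = verts \<phi>" "e \<in> arcs \<phi> - arcs G"
    using less.prems by blast
  then show ?case
  proof cases
    case 1
    then have "G = \<phi>" using less.prems by (intro pre_digraph.equality) auto
    then show ?thesis using assms by (simp add: decomposable_identity)
  next
    case (2 v)
    let ?H = "G\<lparr>verts := insert v (verts G)\<rparr>"
    have "wf_digraph ?H" by unfold_locales auto
    moreover have "card (verts \<phi> - insert v (verts G)) < card (verts \<phi> - verts G)"
      by (rule psubset_card_mono) (use 2 in auto)
    ultimately show ?thesis
      using assms less.prems 2
      by (intro decomposable_step[where H = ?H and G = G and \<sigma> = "\<lambda>x. x" and Q = "\<lambda>a. [a]"
            and \<omega>' = "\<lambda>x. x" and P' = "\<lambda>a. [a]"] path_hom_inclusion less.hyps)
        (auto simp: same_ends_on_def elementary_def induced_by_adding_vertex_def edge_path_def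
          phi.wf_digraph_axioms)
  next
    case (3 e)
    let ?H = "G\<lparr>arcs := insert e (arcs G)\<rparr>"
    have "wf_digraph ?H" by unfold_locales (use 3 less.prems in auto)
    moreover have "card (arcs \<phi> - insert e (arcs G)) < card (arcs \<phi> - arcs G)"
      by (rule psubset_card_mono) (use 3 in auto)
    moreover have "induced_by_adding_edge G ?H (path_functor_of (\<lambda>x. x) (\<lambda>a. [a]))"
      unfolding induced_by_adding_edge_def
      by (intro exI[of _ e] exI[of _ "tail \<phi> e"] exI[of _ "head \<phi> e"])
        (use 3 less.prems in \<open>auto simp: same_ends_on_def edge_path_def\<close>)
    ultimately show ?thesis
      using assms less.prems 3
      by (intro decomposable_step[where H = ?H and G = G and \<sigma> = "\<lambda>x. x" and Q = "\<lambda>a. [a]"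
            and \<omega>' = "\<lambda>x. x" and P' = "\<lambda>a. [a]"] path_hom_inclusion less.hyps)
        (auto simp: same_ends_on_def elementary_def phi.wf_digraph_axioms)
  qed
qed

text \<open>An embedding is an isomorphism onto its image followed by the inclusion of that image.
  The image inherits the total end maps of \<phi>, as \<open>decomposable_inclusion\<close>
  demands.\<close>

lemma decomposable_embedding:
  assumes "causal_network \<phi>" "fin_digraph \<phi>" "causal_network G"
    and "path_hom G \<phi> \<omega> (\<lambda>a. [\<pi> a])" "inj_on \<omega> (verts G)" "inj_on \<pi> (arcs G)"
  shows "decomposable \<phi> G (path_functor_of \<omega> (\<lambda>a. [\<pi> a]))"
proof -
  interpret phi: fin_digraph \<phi> by fact
  interpret G: wf_digraph G using assms(3) by (simp add: causal_network_iff)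
  have \<pi>: "\<pi> a \<in> arcs \<phi>" "tail \<phi> (\<pi> a) = \<omega> (tail G a)" "head \<phi> (\<pi> a) = \<omega> (head G a)"
    if "a \<in> arcs G" for a
    using assms(4) that by (auto simp: path_hom_def awalk_singleton_iff phi.wf_digraph_axioms)
  let ?h = "\<lparr>iso_verts = \<omega>, iso_arcs = \<pi>, iso_head = head \<phi>, iso_tail = tail \<phi>\<rparr>"
  let ?H = "app_iso ?h G"
  have iso: "G.digraph_isomorphism ?h"
    using assms \<pi> by (auto simp: G.digraph_isomorphism_def G.wf_digraph_axioms)
  have H: "wf_digraph ?H" using iso by (rule G.wf_digraphI_app_iso)
  have "induced_by_isomorphism G ?H (path_functor_of \<omega> (\<lambda>a. [\<pi> a]))"
    unfolding induced_by_isomorphism_def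
    by (intro exI[of _ ?h]) (use iso \<pi> in \<open>auto simp: edge_path_def\<close>)
  moreover have "path_hom G ?H \<omega> (\<lambda>a. [\<pi> a])"
    using \<pi> H by (auto simp: path_hom_def awalk_singleton_iff)
  moreover have "path_hom ?H \<phi> (\<lambda>x. x) (\<lambda>a. [a])"
    using \<pi> assms(4)
    by (intro path_hom_inclusion) (auto simp: phi.wf_digraph_axioms path_hom_def same_ends_on_def)
  ultimately show ?thesis
    using assms H \<pi>
    by (intro decomposable_step[where H = ?H and G = G and \<sigma> = "\<omega>" and Q = "\<lambda>a. [\<pi> a]"
          and \<omega>' = "\<lambda>x. x" and P' = "\<lambda>a. [a]"] decomposable_inclusion)
      (auto simp: elementary_def path_hom_def)
qed

section \<open>Merging parallel edges\<close>

text \<open>Since \<omega> is injective, edges with the same image are parallel; merging them in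
  pairs makes \<pi> injective.\<close>

lemma decomposable_inj_on_verts:
  assumes "causal_network \<phi>" "fin_digraph \<phi>" "causal_network G" "fin_digraph G"
    and "path_hom G \<phi> \<omega> (\<lambda>a. [\<pi> a])" "inj_on \<omega> (verts G)"
  shows "decomposable \<phi> G (path_functor_of \<omega> (\<lambda>a. [\<pi> a]))"
  using assms(3-)
proof (induction "card (arcs G)" arbitrary: G rule: less_induct)
  case less
  interpret phi: fin_digraph \<phi> by fact
  interpret G: fin_digraph G using less by simp
  have \<pi>: "tail \<phi> (\<pi> a) = \<omega> (tail G a)" "head \<phi> (\<pi> a) = \<omega> (head G a)" if "a \<in> arcs G" for a
    using less.prems that by (auto simp: path_hom_def awalk_singleton_iff phi.wf_digraph_axioms)
  show ?case
  proof (cases "inj_on \<pi> (arcs G)")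
    case True
    then show ?thesis using less.prems assms by (intro decomposable_embedding) auto
  next
    case False
    then obtain a b where ab: "a \<in> arcs G" "b \<in> arcs G" "a \<noteq> b" "\<pi> a = \<pi> b"
      by (auto simp: inj_on_def)
    have ends: "tail G b = tail G a" "head G b = head G a"
      using ab \<pi>[of a] \<pi>[of b] less.prems(4) by (auto dest: inj_onD)
    \<comment> \<open>The merged edge reuses the name \<open>a\<close>, so the operation just
      deletes \<open>b\<close>, and \<omega> and \<pi> serve unchanged for the smaller
      graph.\<close>
    let ?H = "G\<lparr>arcs := arcs G - {b}\<rparr>" and ?Q = "\<lambda>c. [if c = b then a else c]"
    have H: "wf_digraph ?H" "fin_digraph ?H" by unfold_locales auto
    have "card (arcs ?H) < card (arcs G)" by (rule psubset_card_mono) (use ab in auto)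
    moreover have "induced_by_coarse_graining_edges G ?H (path_functor_of (\<lambda>x. x) ?Q)"
      unfolding induced_by_coarse_graining_edges_def
      by (intro exI[of _ "{a, b}"] exI[of _ a] exI[of _ "tail G a"] exI[of _ "head G a"])
        (use ab ends in \<open>auto simp: edge_path_def same_ends_on_def\<close>)
    moreover have "path_hom G ?H (\<lambda>x. x) ?Q"
      using ab ends H by (auto simp: path_hom_def awalk_singleton_iff)
    moreover have "path_hom ?H \<phi> \<omega> (\<lambda>a. [\<pi> a])"
      using less.prems by (auto simp: path_hom_def)
    ultimately show ?thesis
      using assms less.prems ab H
      by (intro decomposable_step[where H = ?H and G = G and \<sigma> = "\<lambda>x. x" and Q = ?Q
            and \<omega>' = \<omega> and P' = "\<lambda>a. [\<pi> a]"] less.hyps)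
        (auto simp: elementary_def)
  qed
qed

section \<open>Shrinking the fibres of the vertex map\<close>

lemma decomposable_cong:
  assumes "decomposable \<phi> G F'" "functor_eq (path_category G) F F'"
  shows "decomposable \<phi> G F"
  using assms
  by cases (auto intro: decomposable.intros simp: functor_eq_def)

text \<open>Shrinking a fibre with at least two vertices lowers the number of vertices and leaves
  \<omega> and \<open>P\<close> unchanged, so the length bound persists.\<close>

lemma decomposable_short:
  assumes "causal_network \<phi>" "fin_digraph \<phi>" "causal_network G" "fin_digraph G"
    and "path_hom G \<phi> \<omega> P" "\<forall>a\<in>arcs G. length (P a) \<le> 1"
  shows "decomposable \<phi> G (path_functor_of \<omega> P)"
  using assms(3-)
proof (induction "card (verts G)" arbitrary: G rule: less_induct)
  case less
  interpret phi: fin_digraph \<phi> by fact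
  interpret G: fin_digraph G using less by simp
  have collapsed: "\<omega> (tail G a) = \<omega> (head G a)" if "a \<in> arcs G" "P a = []" for a
    using less.prems(3) that by (auto simp: path_hom_def phi.awalk_Nil_iff)
  show ?case
  proof (cases "inj_on \<omega> (verts G)")
    case True
    \<comment> \<open>With \<omega> injective, an edge with empty image would be a loop, which
      acyclicity of \<open>G\<close> forbids.\<close>
    have "P a = [hd (P a)]" if "a \<in> arcs G" for a
    proof (cases "P a")
      case Nil
      then have "tail G a = head G a" using inj_onD[OF True collapsed] that by simp
      then have "G.awalk (tail G a) [a] (tail G a)"
        using that by (simp add: awalk_singleton_iff G.wf_digraph_axioms)
      then show ?thesis using less.prems(1) by (auto simp: causal_network_iff)
    next
      case (Cons b q)
      then show ?thesis using less.prems(4) that by fastforce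
    qed
    note single = this
    have "concat (map P p) = concat (map (\<lambda>a. [hd (P a)]) p)" if "set p \<subseteq> arcs G" for p
      using that single by (induction p) auto
    then have "functor_eq (path_category G) (path_functor_of \<omega> P)
        (path_functor_of \<omega> (\<lambda>a. [hd (P a)]))"
      by (auto simp: functor_eq_def elim!: G.awalkE')
    moreover have "path_hom G \<phi> \<omega> (\<lambda>a. [hd (P a)])"
      using less.prems(3) single by (auto simp: path_hom_def)
    ultimately show ?thesis
      using True less.prems(1,2) assms(1,2)
      by (intro decomposable_cong[OF decomposable_inj_on_verts])
  next
    case False
    then obtain x y where xy: "x \<in> verts G" "y \<in> verts G" "x \<noteq> y" "\<omega> x = \<omega> y"
      by (auto simp: inj_on_def)
    \<comment> \<open>The whole fibre is shrunk, not just \<open>x\<close> and \<open>y\<close>: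
      merging the two ends of a longer path inside the fibre would create a cycle. A collapsed edge
      has both ends in one fibre, so those that survive avoid \<open>S\<close> and keep their
      ends.\<close>
    define S where "S = {z \<in> verts G. \<omega> z = \<omega> x}"
    define \<sigma> where "\<sigma> = (\<lambda>z. if z \<in> S then x else z)"
    define Q where "Q = (\<lambda>a. if a \<in> arcs (G \<restriction> S) then [] else [a])"
    define H where "H = \<lparr>verts = insert x (verts G - S), arcs = arcs G - arcs (G \<restriction> S),
      tail = \<sigma> \<circ> tail G, head = \<sigma> \<circ> head G\<rparr>"
    have H_simps [simp]: "verts H = insert x (verts G - S)" "arcs H = arcs G - arcs (G \<restriction> S)"
      "tail H = \<sigma> \<circ> tail G" "head H = \<sigma> \<circ> head G"
      by (simp_all add: H_def)
    have arcs_S: "arcs (G \<restriction> S) = {a \<in> arcs G. tail G a \<in> S \<and> head G a \<in> S}"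
      by (simp add: induce_subgraph_def)
    have \<omega>_\<sigma> [simp]: "\<omega> (\<sigma> z) = \<omega> z" for z by (simp add: \<sigma>_def S_def)
    have H: "wf_digraph H" "fin_digraph H" by unfold_locales (auto simp: \<sigma>_def)
    have "S \<subseteq> verts G" "x \<in> S" "y \<in> S" using xy by (auto simp: S_def)
    have "verts H \<subset> verts G" using xy \<open>x \<in> S\<close> \<open>y \<in> S\<close> by auto
    then have less_H: "card (verts H) < card (verts G)" by (intro psubset_card_mono) auto
    show ?thesis
    proof (rule decomposable_step[where H = H and G = G and \<sigma> = \<sigma> and Q = Q and \<omega>' = \<omega> and P' = P])
      show "path_hom G H \<sigma> Q"
        using \<open>x \<in> S\<close> H(1)
        by (auto simp: path_hom_def Q_def awalk_singleton_iff wf_digraph.awalk_Nil_iff arcs_S)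
          (auto simp: \<sigma>_def split: if_splits)
      show hom: "path_hom H \<phi> \<omega> P" using less.prems(3) xy by (auto simp: path_hom_def)
      show "a \<in> arcs G \<and> tail G a = tail H a \<and> head G a = head H a"
        if "a \<in> arcs H" "P a = []" for a
        using that collapsed[of a] by (auto simp: \<sigma>_def arcs_S S_def)
      have "induced_by_coarse_graining_vertices G H (path_functor_of \<sigma> Q)"
        unfolding induced_by_coarse_graining_vertices_def
        by (intro exI[of _ S] exI[of _ x])
          (use \<open>S \<subseteq> verts G\<close> \<open>x \<in> S\<close> in \<open>auto simp: edge_path_def \<sigma>_def Q_def arcs_S\<close>)
      then show "elementary G H (path_functor_of \<sigma> Q)" if "cau_morphism G H (path_functor_of \<sigma> Q)"
        using that by (simp add: elementary_def)
      show "decomposable \<phi> H (path_functor_of \<omega> P)" if "causal_network H"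
        using less.hyps[OF less_H that H(2) hom] less.prems(4) by simp
      show "P a = concat (map P (Q a))" if "a \<in> arcs G" for a
      proof (cases "a \<in> arcs (G \<restriction> S)")
        case True
        \<comment> \<open>The image of an edge inside the fibre is a closed walk in \<phi>, hence
          empty, matching the empty \<open>Q a\<close>.\<close>
        then have "\<omega> (tail G a) = \<omega> (head G a)" by (auto simp: arcs_S S_def)
        then show ?thesis
          using less.prems(3) assms(1) that True
          by (auto simp: path_hom_def causal_network_iff Q_def)
      qed (auto simp: Q_def)
    qed (use assms less.prems H in auto)
  qed
qed

section \<open>Subdividing edges with long images\<close>

text \<open>The measure is the total excess of image lengths over one; truncated subtraction lets
  edges of length 0 or 1 contribute nothing. Each subdivision splits off the first edge of a long
  image. The infinite types supply the fresh names.\<close>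

lemma decomposable_path_hom:
  fixes \<phi> G :: "('v, 'e) pre_digraph"
  assumes "infinite (UNIV :: 'v set)" "infinite (UNIV :: 'e set)"
    and "causal_network \<phi>" "fin_digraph \<phi>" "causal_network G" "fin_digraph G"
    and "path_hom G \<phi> \<omega> P"
  shows "decomposable \<phi> G (path_functor_of \<omega> P)"
  using assms(5-)
proof (induction "\<Sum>a\<in>arcs G. length (P a) - 1" arbitrary: G \<omega> P rule: less_induct)
  case less
  interpret phi: fin_digraph \<phi> by fact
  interpret G: fin_digraph G using less by simp
  show ?case
  proof (cases "\<forall>a\<in>arcs G. length (P a) \<le> 1")
    case True
    then show ?thesis using less.prems assms by (intro decomposable_short) auto
  next
    case False
    then obtain e where e: "e \<in> arcs G" "length (P e) > 1" by auto
    then obtain b q where P_e: "P e = b # q" "q \<noteq> []"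
      by (metis One_nat_def length_0_conv length_Cons less_irrefl list.exhaust not_less_zero)
    obtain v where v: "v \<notin> verts G" using ex_new_if_finite[OF assms(1) G.finite_verts] by auto
    obtain e' where e': "e' \<notin> arcs G" using ex_new_if_finite[OF assms(2) G.finite_arcs] by auto
    then have "e' \<noteq> e" using e by auto
    \<comment> \<open>The first half keeps the name \<open>e\<close> and now ends at
      \<open>v\<close>; the second half is \<open>e'\<close>.\<close>
    define H where "H = \<lparr>verts = insert v (verts G), arcs = insert e' (arcs G),
      tail = (tail G)(e' := v), head = (head G)(e := v, e' := head G e)\<rparr>"
    have H_simps [simp]: "verts H = insert v (verts G)" "arcs H = insert e' (arcs G)"
      "tail H = (tail G)(e' := v)" "head H = (head G)(e := v, e' := head G e)"
      by (simp_all add: H_def)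
    \<comment> \<open>The new vertex goes to the point where \<open>b # q\<close> is cut, the two
      halves to the two pieces.\<close>
    define \<omega>' where "\<omega>' = \<omega>(v := head \<phi> b)"
    define P' where "P' = P(e := [b], e' := q)"
    define Q where "Q = (\<lambda>a. if a = e then [e, e'] else [a])"
    have H: "wf_digraph H" "fin_digraph H"
      by unfold_locales (use e in auto)
    have walk_e: "b \<in> arcs \<phi>" "tail \<phi> b = \<omega> (tail G e)" "phi.awalk (head \<phi> b) q (\<omega> (head G e))"
      using less.prems(3) e(1) P_e by (auto simp: path_hom_def phi.awalk_Cons_iff)
    have \<omega>': "\<omega>' z = \<omega> z" if "z \<in> verts G" for z using that v by (auto simp: \<omega>'_def)
    have neq: "tail G a \<noteq> v" "head G a \<noteq> v" if "a \<in> arcs G" for a using that v by auto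
    have "(\<Sum>a\<in>arcs H. length (P' a) - 1) < (\<Sum>a\<in>arcs G. length (P a) - 1)"
    proof -
      \<comment> \<open>Only \<open>e\<close> matters: its excess \<open>length q\<close> is
        replaced by 0 for \<open>e\<close> and \<open>length q - 1\<close> for \<open>e'\<close>, a
        strict drop because \<open>q\<close> is nonempty.\<close>
      have "(\<Sum>a\<in>arcs G - {e}. length (P' a) - 1) = (\<Sum>a\<in>arcs G - {e}. length (P a) - 1)"
        using e' by (intro sum.cong) (auto simp: P'_def)
      moreover have "length (P' e) = 1" "length (P' e') = length q" "length (P e) = Suc (length q)"
        using P_e \<open>e' \<noteq> e\<close> by (auto simp: P'_def)
      ultimately show ?thesis
        using e e' P_e by (simp add: sum.remove[of "arcs G" e])
    qed
    note smaller = this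
    show ?thesis
    proof (rule decomposable_step[where H = H and G = G and \<sigma> = "\<lambda>x. x" and Q = Q and \<omega>' = \<omega>' and P' = P'])
      show "path_hom G H (\<lambda>x. x) Q"
        using H(1) e e' \<open>e' \<noteq> e\<close>
        by (auto simp: path_hom_def Q_def awalk_singleton_iff wf_digraph.awalk_Cons_iff
            wf_digraph.awalk_Nil_iff)
      show hom: "path_hom H \<phi> \<omega>' P'"
        using less.prems(3) walk_e e e' \<open>e' \<noteq> e\<close> neq v
        by (auto simp: path_hom_def P'_def \<omega>'_def awalk_singleton_iff phi.wf_digraph_axioms)
      \<comment> \<open>Both halves have nonempty images, so every collapsed edge is an untouched
        edge of \<open>G\<close>.\<close>
      show "a \<in> arcs G \<and> tail G a = tail H a \<and> head G a = head H a"
        if "a \<in> arcs H" "P' a = []" for a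
        using that P_e \<open>e' \<noteq> e\<close> by (auto simp: P'_def split: if_splits)
      have "induced_by_subdividing_edge G H (path_functor_of (\<lambda>x. x) Q)"
        unfolding induced_by_subdividing_edge_def
        by (intro exI[of _ e] exI[of _ v] exI[of _ e] exI[of _ e'])
          (use e e' v \<open>e' \<noteq> e\<close> in \<open>auto simp: edge_path_def Q_def same_ends_on_def\<close>)
      then show "elementary G H (path_functor_of (\<lambda>x. x) Q)"
        if "cau_morphism G H (path_functor_of (\<lambda>x. x) Q)"
        using that by (simp add: elementary_def)
      show "decomposable \<phi> H (path_functor_of \<omega>' P')" if "causal_network H"
        by (rule less.hyps[OF smaller that H(2) hom])
      show "\<omega> x = \<omega>' x" if "x \<in> verts G" for x using \<omega>'[OF that] by simp
      show "P a = concat (map P' (Q a))" if "a \<in> arcs G" for a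
        using that e' P_e \<open>e' \<noteq> e\<close> by (auto simp: P'_def Q_def)
    qed (use assms less.prems H in auto)
  qed
qed

theorem theorem1:
  fixes \<psi> \<phi> :: "('v, 'e) pre_digraph"
    and f :: "('v, 'e, 'v, 'e) path_functor"
  assumes "infinite (UNIV :: 'v set)" and "infinite (UNIV :: 'e set)"
    and "causal_network \<psi>" and "causal_network \<phi>"
    and "fin_digraph \<psi>" and "fin_digraph \<phi>"
    and "cau_morphism \<psi> \<phi> f"
  shows "\<exists>n\<ge>1. \<exists>(G :: nat \<Rightarrow> ('v, 'e) pre_digraph) (g :: nat \<Rightarrow> ('v, 'e, 'v, 'e) path_functor).
    G 0 = \<psi> \<and> G n = \<phi> \<and>
    (\<forall>i\<in>{1..n}. elementary (G (i - 1)) (G i) (g i)) \<and>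
    functor_eq (path_category \<psi>) f (comp_functors g n)"
proof -
  obtain \<omega> P where "path_hom \<psi> \<phi> \<omega> P" "functor_eq (path_category \<psi>) f (path_functor_of \<omega> P)"
    using functor_eq_path_functor_of[of \<psi> \<phi> f] assms(7)
    by (auto simp: cau_morphism_def causal_network_iff)
  then have "decomposable \<phi> \<psi> f"
    using assms by (blast intro: decomposable_cong decomposable_path_hom)
  then show ?thesis by (rule decomposable_chain)
qed

end
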